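(* Let $F$ be a field of characteristic zero and let $q\in F\setminus\{0\}$. Let $f=ax^{2}+bxy+cy^{2}$ with $a,b,c\in F$ be a nonzero quadratic form in the quantum plane $\mathcal{O}_q(F^2)$, and let $\Delta_q(f)=b^{2}-4acq$ be its quantum discriminant. Then $f$ is reducible in $\mathcal{O}_q(F^2)$ if and only if $\Delta_q(f)=d^{2}$ for some $d\in F$.
   Context: The quantum plane $\mathcal{O}_q(F^2)$ is the $F$-algebra generated by two variables $x,y$ subject to the single relation $yx=qxy$; the elements $x^iy^j$ ($i,j\in\mathbb{N}=\{0,1,2,\dots\}$) form an $F$-basis, and the elements of $\mathcal{O}_q(F^2)$ are called polynomials. A nonzero polynomial $f\in\mathcal{O}_q(F^2)$ is reducible if $f=gh$ for some nonconstant $g,h\in\mathcal{O}_q(F^2)$ (constants are the elements of $F$). A quadratic form is a nonzero polynomial that can be written as $ax^2+bxy+cy^2$ with $a,b,c\in F$. *)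

theory Defs
  imports Complex_Main "HOL-Library.Poly_Mapping"
begin

(* The quantum plane is modelled on its basis of monomials: the finitely supported coefficient
   function f stands for the sum of lookup f (i, j) times x^i y^j.  The relation y x = q x y
   gives (x^i y^j) (x^k y^l) = q^(j k) x^(i+k) y^(j+l), which is extended bilinearly.
   The ring "*" that the library puts on this type is the commutative case and is not used. *)

type_synonym 'a qplane = "(nat \<times> nat) \<Rightarrow>\<^sub>0 'a"

definition qp_mult :: "'a::comm_ring_1 \<Rightarrow> 'a qplane \<Rightarrow> 'a qplane \<Rightarrow> 'a qplane" where
  "qp_mult q f g =
    (\<Sum>(i, j) \<in> Poly_Mapping.keys f. \<Sum>(k, l) \<in> Poly_Mapping.keys g.
      Poly_Mapping.single (i + k, j + l)
        (Poly_Mapping.lookup f (i, j) * Poly_Mapping.lookup g (k, l) * q ^ (j * k)))"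

abbreviation qp_mult_syntax :: "'a::comm_ring_1 qplane \<Rightarrow> 'a \<Rightarrow> 'a qplane \<Rightarrow> 'a qplane"
    ("(_ \<star>\<^bsub>_\<^esub>/ _)" [70, 0, 71] 70) where
  "f \<star>\<^bsub>q\<^esub> g \<equiv> qp_mult q f g"

definition qp_const :: "'a::comm_ring_1 \<Rightarrow> 'a qplane" where
  "qp_const c = Poly_Mapping.single (0, 0) c"

definition qp_x :: "'a::comm_ring_1 qplane" where
  "qp_x = Poly_Mapping.single (1, 0) 1"

definition qp_y :: "'a::comm_ring_1 qplane" where
  "qp_y = Poly_Mapping.single (0, 1) 1"

definition qp_reducible :: "'a::field \<Rightarrow> 'a qplane \<Rightarrow> bool" where
  "qp_reducible q f \<longleftrightarrow>
    f \<noteq> 0 \<and> (\<exists>g h. g \<notin> range qp_const \<and> h \<notin> range qp_const \<and> f = g \<star>\<^bsub>q\<^esub> h)"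

(* The remaining facts check the model: the product makes it an associative unital algebra
   over the central subring of constants, y x = q x y holds, the ordered monomials are its
   basis, and it has the universal property of the presentation by x, y and y x = q x y. *)

lemma qp_sum_single:
  fixes f :: "'a::comm_ring_1 qplane"
  shows "f = (\<Sum>k \<in> Poly_Mapping.keys f. Poly_Mapping.single k (Poly_Mapping.lookup f k))"
  by (rule poly_mapping_eqI)
    (simp add: lookup_sum lookup_single when_def in_keys_iff)

lemma qp_induct [case_names zero single add]:
  fixes f :: "'a::comm_ring_1 qplane"
  assumes "P 0" "\<And>i j c. P (Poly_Mapping.single (i, j) c)"
    and "\<And>f g. P f \<Longrightarrow> P g \<Longrightarrow> P (f + g)"
  shows "P f"
proof -
  have "P (\<Sum>k \<in> A. Poly_Mapping.single k (Poly_Mapping.lookup f k))" if "finite A" for A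
    using that by induction (use assms in auto)
  from this[of "Poly_Mapping.keys f"] show ?thesis
    by (simp flip: qp_sum_single)
qed

lemma qp_mult_add_left: "(f + g) \<star>\<^bsub>q\<^esub> h = f \<star>\<^bsub>q\<^esub> h + g \<star>\<^bsub>q\<^esub> h"
  unfolding qp_mult_def case_prod_unfold prod.collapse
  by (rule setsum_keys_plus_distrib)
    (simp_all add: distrib_right single_add sum.distrib)

lemma qp_mult_add_right: "f \<star>\<^bsub>q\<^esub> (g + h) = f \<star>\<^bsub>q\<^esub> g + f \<star>\<^bsub>q\<^esub> h"
proof -
  have "(\<Sum>n \<in> Poly_Mapping.keys (g + h). Poly_Mapping.single (i + fst n, j + snd n)
          (c * Poly_Mapping.lookup (g + h) n * q ^ (j * fst n))) =
        (\<Sum>n \<in> Poly_Mapping.keys g. Poly_Mapping.single (i + fst n, j + snd n)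
          (c * Poly_Mapping.lookup g n * q ^ (j * fst n))) +
        (\<Sum>n \<in> Poly_Mapping.keys h. Poly_Mapping.single (i + fst n, j + snd n)
          (c * Poly_Mapping.lookup h n * q ^ (j * fst n)))" for i j c
    by (rule setsum_keys_plus_distrib) (simp_all add: algebra_simps single_add)
  then show ?thesis
    unfolding qp_mult_def case_prod_unfold prod.collapse by (simp add: sum.distrib)
qed

lemma qp_mult_zero [simp]: "0 \<star>\<^bsub>q\<^esub> f = 0" "f \<star>\<^bsub>q\<^esub> 0 = 0"
  by (simp_all add: qp_mult_def)

lemma qp_mult_single:
  "Poly_Mapping.single (i, j) a \<star>\<^bsub>q\<^esub> Poly_Mapping.single (k, l) b =
   Poly_Mapping.single (i + k, j + l) (a * b * q ^ (j * k))"
  by (simp add: qp_mult_def)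

lemma qp_mult_assoc: "(f \<star>\<^bsub>q\<^esub> g) \<star>\<^bsub>q\<^esub> h = f \<star>\<^bsub>q\<^esub> (g \<star>\<^bsub>q\<^esub> h)"
proof (induction f rule: qp_induct)
  case (single i j a)
  show ?case
  proof (induction g rule: qp_induct)
    case (single k l b)
    show ?case
      by (induction h rule: qp_induct)
        (simp_all add: qp_mult_single qp_mult_add_right algebra_simps power_add)
  qed (simp_all add: qp_mult_add_left qp_mult_add_right)
qed (simp_all add: qp_mult_add_left)

lemma qp_mult_one: "qp_const 1 \<star>\<^bsub>q\<^esub> f = f" "f \<star>\<^bsub>q\<^esub> qp_const 1 = f"
  by (induction f rule: qp_induct)
    (simp_all add: qp_const_def qp_mult_single qp_mult_add_left qp_mult_add_right)

lemma qp_const_central: "qp_const c \<star>\<^bsub>q\<^esub> f = f \<star>\<^bsub>q\<^esub> qp_const c"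
  by (induction f rule: qp_induct)
    (simp_all add: qp_const_def qp_mult_single qp_mult_add_left qp_mult_add_right mult.commute)

lemma qp_const_hom:
  "qp_const (a + b) = qp_const a + qp_const b"
  "qp_const (a * b) = qp_const a \<star>\<^bsub>q\<^esub> qp_const b"
  by (simp_all add: qp_const_def single_add qp_mult_single)

lemma qp_relation: "qp_y \<star>\<^bsub>q\<^esub> qp_x = qp_const q \<star>\<^bsub>q\<^esub> (qp_x \<star>\<^bsub>q\<^esub> qp_y)"
  by (simp add: qp_x_def qp_y_def qp_const_def qp_mult_single)

lemma qp_monomial:
  "qp_const c \<star>\<^bsub>q\<^esub> (((qp_mult q qp_x ^^ i) (qp_const 1)) \<star>\<^bsub>q\<^esub> ((qp_mult q qp_y ^^ j) (qp_const 1))) =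
   Poly_Mapping.single (i, j) c"
proof -
  have "(qp_mult q qp_x ^^ i) (qp_const 1) = Poly_Mapping.single (i, 0) 1"
    by (induction i) (simp_all add: qp_const_def qp_x_def qp_mult_single)
  moreover have "(qp_mult q qp_y ^^ j) (qp_const 1) = Poly_Mapping.single (0, j) 1"
    by (induction j) (simp_all add: qp_const_def qp_y_def qp_mult_single)
  ultimately show ?thesis
    by (simp add: qp_const_def qp_mult_single)
qed

lemma qp_universal:
  fixes \<phi> :: "'a::comm_ring_1 \<Rightarrow> 'b::ring_1" and X Y :: 'b
  assumes add: "\<And>a b. \<phi> (a + b) = \<phi> a + \<phi> b" and mult: "\<And>a b. \<phi> (a * b) = \<phi> a * \<phi> b"
    and one: "\<phi> 1 = 1" and central: "\<And>a z. \<phi> a * z = z * \<phi> a"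
    and rel: "Y * X = \<phi> q * (X * Y)"
  shows "\<exists>!\<Phi>. (\<forall>f g. \<Phi> (f + g) = \<Phi> f + \<Phi> g) \<and> (\<forall>f g. \<Phi> (f \<star>\<^bsub>q\<^esub> g) = \<Phi> f * \<Phi> g) \<and>
               (\<forall>c. \<Phi> (qp_const c) = \<phi> c) \<and> \<Phi> qp_x = X \<and> \<Phi> qp_y = Y"
proof -
  have zero: "\<phi> 0 = 0"
    using add[of 0 0] by simp
  have swap: "z * (\<phi> a * w) = \<phi> a * (z * w)" for z a w
    using central[of a z] by (simp flip: mult.assoc)
  have YX: "Y ^ j * X = \<phi> (q ^ j) * (X * Y ^ j)" for j
  proof (induction j)
    case (Suc j)
    have "Y ^ Suc j * X = \<phi> (q ^ j) * (Y * X * Y ^ j)"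
      by (simp add: Suc mult.assoc swap[of Y])
    also have "\<dots> = \<phi> (q ^ j * q) * (X * Y ^ Suc j)"
      by (simp add: rel mult mult.assoc)
    finally show ?case
      by (simp add: mult.commute)
  qed (simp add: one)
  have YXk: "Y ^ j * X ^ k = \<phi> (q ^ (j * k)) * (X ^ k * Y ^ j)" for j k
  proof (induction k)
    case (Suc k)
    have "Y ^ j * X ^ Suc k = Y ^ j * X * X ^ k"
      by (simp add: mult.assoc)
    also have "\<dots> = \<phi> (q ^ j) * (X * (Y ^ j * X ^ k))"
      by (simp only: YX mult.assoc)
    also have "\<dots> = \<phi> (q ^ j * q ^ (j * k)) * (X ^ Suc k * Y ^ j)"
      by (simp add: Suc swap[of X] mult mult.assoc)
    finally show ?case
      by (simp add: power_add)
  qed (simp add: one)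
  define \<Phi> where "\<Phi> f = (\<Sum>n \<in> Poly_Mapping.keys f.
      \<phi> (Poly_Mapping.lookup f n) * (X ^ fst n * Y ^ snd n))" for f
  have \<Phi>_single: "\<Phi> (Poly_Mapping.single (i, j) c) = \<phi> c * (X ^ i * Y ^ j)" for i j c
    by (simp add: \<Phi>_def zero)
  have \<Phi>_add: "\<Phi> (f + g) = \<Phi> f + \<Phi> g" for f g
    unfolding \<Phi>_def by (rule setsum_keys_plus_distrib) (simp_all add: zero add distrib_right)
  have \<Phi>_zero: "\<Phi> 0 = 0"
    by (simp add: \<Phi>_def)
  have mono: "\<phi> (a * b * q ^ (j * k)) * (X ^ (i + k) * Y ^ (j + l)) =
      \<phi> a * (X ^ i * Y ^ j) * (\<phi> b * (X ^ k * Y ^ l))" for a b i j k l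
  proof -
    have "X ^ i * Y ^ j * (X ^ k * Y ^ l) = X ^ i * (Y ^ j * X ^ k * Y ^ l)"
      by (simp only: mult.assoc)
    also have "\<dots> = \<phi> (q ^ (j * k)) * (X ^ (i + k) * Y ^ (j + l))"
      by (simp add: YXk mult.assoc swap[of "X ^ i"] power_add)
    finally show ?thesis
      by (simp only: mult.assoc[of "\<phi> a"] mult.assoc[of "\<phi> b"] swap[of "X ^ i * Y ^ j"] mult)
  qed
  have \<Phi>_mult: "\<Phi> (f \<star>\<^bsub>q\<^esub> g) = \<Phi> f * \<Phi> g" for f g
  proof (induction f rule: qp_induct)
    case (single i j a)
    show ?case
      by (induction g rule: qp_induct)
        (simp_all add: qp_mult_single \<Phi>_single mono \<Phi>_zero qp_mult_add_right \<Phi>_add distrib_left)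
  qed (simp_all add: \<Phi>_zero qp_mult_add_left \<Phi>_add distrib_right)
  show ?thesis
  proof (rule ex1I[of _ \<Phi>], intro conjI allI)
    show "\<Phi> (qp_const c) = \<phi> c" for c
      by (simp add: qp_const_def \<Phi>_single)
    show "\<Phi> qp_x = X" "\<Phi> qp_y = Y"
      by (simp_all add: qp_x_def qp_y_def \<Phi>_single one)
  next
    fix \<Psi> :: "'a qplane \<Rightarrow> 'b"
    assume \<Psi>: "(\<forall>f g. \<Psi> (f + g) = \<Psi> f + \<Psi> g) \<and> (\<forall>f g. \<Psi> (f \<star>\<^bsub>q\<^esub> g) = \<Psi> f * \<Psi> g) \<and>
      (\<forall>c. \<Psi> (qp_const c) = \<phi> c) \<and> \<Psi> qp_x = X \<and> \<Psi> qp_y = Y"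
    then have \<Psi>_add: "\<Psi> (f + g) = \<Psi> f + \<Psi> g" and \<Psi>_mult: "\<Psi> (f \<star>\<^bsub>q\<^esub> g) = \<Psi> f * \<Psi> g" for f g
      by blast+
    have \<Psi>_zero: "\<Psi> 0 = 0"
      using \<Psi>_add[of 0 0] by simp
    have "\<Psi> ((qp_mult q qp_x ^^ i) (qp_const 1)) = X ^ i" for i
      by (induction i) (use \<Psi> in \<open>simp_all add: one\<close>)
    moreover have "\<Psi> ((qp_mult q qp_y ^^ j) (qp_const 1)) = Y ^ j" for j
      by (induction j) (use \<Psi> in \<open>simp_all add: one\<close>)
    ultimately have \<Psi>_single: "\<Psi> (Poly_Mapping.single (i, j) c) = \<phi> c * (X ^ i * Y ^ j)" for i j c
      using \<Psi> arg_cong[OF qp_monomial[of q c i j], of \<Psi>] by simp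
    show "\<Psi> = \<Phi>"
    proof
      fix f show "\<Psi> f = \<Phi> f"
        by (induction f rule: qp_induct)
          (simp_all add: \<Psi>_zero \<Phi>_zero \<Psi>_single \<Phi>_single \<Psi>_add \<Phi>_add)
    qed
  qed (simp_all add: \<Phi>_add \<Phi>_mult)
qed

end

theory Submission
  imports Defs "HOL-Library.Product_Lexorder"
begin

text \<open>
  A product of two linear forms \<open>\<alpha>x + \<beta>y\<close> and \<open>\<gamma>x + \<delta>y\<close> has the coefficients \<open>\<alpha>\<gamma>\<close>,
  \<open>\<alpha>\<delta> + q\<beta>\<gamma>\<close> and \<open>\<beta>\<delta>\<close>, and its quantum discriminant is the square of \<open>\<alpha>\<delta> - q\<beta>\<gamma>\<close>.
  This is the commutative identity for the discriminant of a split form, with \<open>\<beta>\<gamma>\<close>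
  replaced by \<open>q\<beta>\<gamma>\<close>.

  If \<open>f\<close> is reducible, total degree forces both factors to have degree one: over a field
  with \<open>q \<noteq> 0\<close> the leading monomials of two factors multiply to a monomial of the product
  (\<open>qp_mult_leading_monomial\<close>), so the degrees add up to two and neither is zero
  (\<open>qp_factors_linear\<close>). The constant terms of the factors do not affect the part of degree two,
  so the identity above applies.

  Conversely, a square root \<open>d\<close> of the discriminant solves for the coefficients
  \<open>\<alpha>, \<beta>, \<gamma>, \<delta>\<close> by the quadratic formula if \<open>a \<noteq> 0\<close>; if \<open>a = 0\<close>, then \<open>y\<close> is a right factor.
\<close>

lemma qp_const_iff_keys:
  "f \<in> range qp_const \<longleftrightarrow> Poly_Mapping.keys f \<subseteq> {(0, 0)}"
proof
  assume "Poly_Mapping.keys f \<subseteq> {(0, 0)}"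
  then have "f = qp_const (Poly_Mapping.lookup f (0, 0))"
    unfolding qp_const_def
    by (intro poly_mapping_eqI) (auto simp: lookup_single when_def in_keys_iff)
  then show "f \<in> range qp_const" by blast
qed (auto simp: qp_const_def split: if_splits)

lemma lookup_qp_mult:
  "Poly_Mapping.lookup (f \<star>\<^bsub>q\<^esub> g) (m, n) =
    (\<Sum>(u, v) \<in> Poly_Mapping.keys f \<times> Poly_Mapping.keys g.
      Poly_Mapping.lookup f u * Poly_Mapping.lookup g v * q ^ (snd u * fst v)
        when fst u + fst v = m \<and> snd u + snd v = n)"
  by (simp add: qp_mult_def lookup_sum lookup_single case_prod_unfold
      sum.cartesian_product)

text \<open>
  Monomials are compared by total degree and then by the exponent of \<open>x\<close>. This order is
  compatible with addition of exponents, which makes the leading monomial multiplicative.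
\<close>

abbreviation qp_rank :: "nat \<times> nat \<Rightarrow> nat \<times> nat" where
  "qp_rank u \<equiv> (fst u + snd u, fst u)"

lemma qp_leading_monomial_exists:
  assumes "f \<noteq> 0"
  obtains u where "u \<in> Poly_Mapping.keys f"
    "\<And>v. v \<in> Poly_Mapping.keys f \<Longrightarrow> qp_rank v \<le> qp_rank u"
proof -
  let ?R = "qp_rank ` Poly_Mapping.keys f"
  have "Max ?R \<in> ?R"
    using assms by (intro Max_in) auto
  then obtain u where "u \<in> Poly_Mapping.keys f" "Max ?R = qp_rank u"
    by blast
  moreover have "qp_rank v \<le> Max ?R" if "v \<in> Poly_Mapping.keys f" for v
    using that by (intro Max_ge) auto
  ultimately show ?thesis
    using that by metis
qed

text \<open>
  By maximality, only the two leading monomials contribute to the product monomial; its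
  coefficient is the product of the leading coefficients times a power of \<open>q\<close>.
\<close>

lemma qp_mult_leading_monomial:
  fixes q :: "'a::field"
  assumes "q \<noteq> 0"
    and u: "u \<in> Poly_Mapping.keys g" "\<And>u'. u' \<in> Poly_Mapping.keys g \<Longrightarrow> qp_rank u' \<le> qp_rank u"
    and v: "v \<in> Poly_Mapping.keys h" "\<And>v'. v' \<in> Poly_Mapping.keys h \<Longrightarrow> qp_rank v' \<le> qp_rank v"
  shows "(fst u + fst v, snd u + snd v) \<in> Poly_Mapping.keys (g \<star>\<^bsub>q\<^esub> h)"
proof -
  have uniq: "u' = u \<and> v' = v"
    if "u' \<in> Poly_Mapping.keys g" "v' \<in> Poly_Mapping.keys h"
      "fst u' + fst v' = fst u + fst v" "snd u' + snd v' = snd u + snd v" for u' v'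
    using u(2)[OF that(1)] v(2)[OF that(2)] that(3,4)
    by (auto simp: prod_eq_iff)
  have "Poly_Mapping.lookup (g \<star>\<^bsub>q\<^esub> h) (fst u + fst v, snd u + snd v) =
      (\<Sum>p \<in> Poly_Mapping.keys g \<times> Poly_Mapping.keys h.
        if p = (u, v) then Poly_Mapping.lookup g u * Poly_Mapping.lookup h v *
          q ^ (snd u * fst v) else 0)"
    unfolding lookup_qp_mult
  proof (intro sum.cong refl)
    fix p assume "p \<in> Poly_Mapping.keys g \<times> Poly_Mapping.keys h"
    then obtain u' v' where p: "p = (u', v')"
        "u' \<in> Poly_Mapping.keys g" "v' \<in> Poly_Mapping.keys h"
      by blast
    show "(case p of (u', v') \<Rightarrow> Poly_Mapping.lookup g u' * Poly_Mapping.lookup h v' *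
          q ^ (snd u' * fst v') when fst u' + fst v' = fst u + fst v \<and> snd u' + snd v' = snd u + snd v) =
        (if p = (u, v) then Poly_Mapping.lookup g u * Poly_Mapping.lookup h v *
          q ^ (snd u * fst v) else 0)"
      using uniq[OF p(2,3)] by (auto simp only: p(1) when_def prod.case prod.inject split: if_splits)
  qed
  also have "\<dots> = Poly_Mapping.lookup g u * Poly_Mapping.lookup h v * q ^ (snd u * fst v)"
    using u(1) v(1) by simp
  also have "\<dots> \<noteq> 0"
    using assms by (simp add: in_keys_iff)
  finally show ?thesis
    by (simp add: in_keys_iff)
qed

lemma qp_factors_linear:
  fixes q :: "'a::field"
  assumes "q \<noteq> 0" and "g \<notin> range qp_const" and "h \<notin> range qp_const"
    and deg: "\<And>i j. (i, j) \<in> Poly_Mapping.keys (g \<star>\<^bsub>q\<^esub> h) \<Longrightarrow> i + j \<le> 2"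
  shows "\<And>i j. (i, j) \<in> Poly_Mapping.keys g \<Longrightarrow> i + j \<le> 1"
    and "\<And>i j. (i, j) \<in> Poly_Mapping.keys h \<Longrightarrow> i + j \<le> 1"
proof -
  have "g \<noteq> 0" "h \<noteq> 0"
    using assms(2,3) by (auto simp: qp_const_iff_keys)
  then obtain u v where
      u: "u \<in> Poly_Mapping.keys g" "\<And>u'. u' \<in> Poly_Mapping.keys g \<Longrightarrow> qp_rank u' \<le> qp_rank u"
    and v: "v \<in> Poly_Mapping.keys h" "\<And>v'. v' \<in> Poly_Mapping.keys h \<Longrightarrow> qp_rank v' \<le> qp_rank v"
    by (metis qp_leading_monomial_exists)
  have le: "fst u + fst v + (snd u + snd v) \<le> 2"
    using qp_mult_leading_monomial[OF \<open>q \<noteq> 0\<close> u v] by (rule deg)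
  \<comment> \<open>A nonconstant factor has a monomial of positive degree, so its leading monomial
    has positive degree too.\<close>
  have "1 \<le> fst u + snd u"
  proof -
    obtain u' where "u' \<in> Poly_Mapping.keys g" "u' \<noteq> (0, 0)"
      using assms(2) by (auto simp: qp_const_iff_keys)
    with u(2)[of u'] show ?thesis by (cases u') auto
  qed
  moreover have "1 \<le> fst v + snd v"
  proof -
    obtain v' where "v' \<in> Poly_Mapping.keys h" "v' \<noteq> (0, 0)"
      using assms(3) by (auto simp: qp_const_iff_keys)
    with v(2)[of v'] show ?thesis by (cases v') auto
  qed
  ultimately have 1: "fst u + snd u = 1" "fst v + snd v = 1"
    using le by linarith+
  show "i + j \<le> 1" if "(i, j) \<in> Poly_Mapping.keys g" for i j
    using u(2)[OF that] 1 by auto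
  show "i + j \<le> 1" if "(i, j) \<in> Poly_Mapping.keys h" for i j
    using v(2)[OF that] 1 by auto
qed

definition qp_affine :: "'a::comm_ring_1 \<Rightarrow> 'a \<Rightarrow> 'a \<Rightarrow> 'a qplane" where
  "qp_affine r \<alpha> \<beta> =
    Poly_Mapping.single (0, 0) r + Poly_Mapping.single (1, 0) \<alpha> + Poly_Mapping.single (0, 1) \<beta>"

definition qp_form :: "'a::comm_ring_1 \<Rightarrow> 'a \<Rightarrow> 'a \<Rightarrow> 'a qplane" where
  "qp_form a b c =
    Poly_Mapping.single (2, 0) a + Poly_Mapping.single (1, 1) b + Poly_Mapping.single (0, 2) c"

lemma qp_affine_if_degree_le_1:
  assumes "\<And>i j. (i, j) \<in> Poly_Mapping.keys f \<Longrightarrow> i + j \<le> 1"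
  shows "\<exists>r \<alpha> \<beta>. f = qp_affine r \<alpha> \<beta>"
proof (intro exI poly_mapping_eqI)
  let ?c = "Poly_Mapping.lookup f"
  fix u :: "nat \<times> nat"
  obtain i j where "u = (i, j)" by fastforce
  moreover have "i + j \<le> 1" if "?c (i, j) \<noteq> 0"
    using assms that by (simp add: in_keys_iff)
  moreover have "(i = 0 \<and> j = 0) \<or> (i = 1 \<and> j = 0) \<or> (i = 0 \<and> j = 1)" if "i + j \<le> 1"
    using that by linarith
  ultimately show
    "?c u = Poly_Mapping.lookup (qp_affine (?c (0, 0)) (?c (1, 0)) (?c (0, 1))) u"
    by (cases "?c u = 0")
      (auto simp: qp_affine_def lookup_add lookup_single when_def)
qed

lemma qp_affine_nonconst:
  assumes "\<alpha> \<noteq> 0 \<or> \<beta> \<noteq> 0"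
  shows "qp_affine r \<alpha> \<beta> \<notin> range qp_const"
proof
  assume "qp_affine r \<alpha> \<beta> \<in> range qp_const"
  then obtain s where s: "qp_affine r \<alpha> \<beta> = qp_const s" by blast
  have "\<alpha> = 0" "\<beta> = 0"
    using arg_cong[OF s, of "\<lambda>p. Poly_Mapping.lookup p (1, 0)"]
      arg_cong[OF s, of "\<lambda>p. Poly_Mapping.lookup p (0, 1)"]
    by (simp_all add: qp_affine_def qp_const_def lookup_add lookup_single when_def)
  with assms show False by simp
qed

lemma qp_affine_mult_top_coeffs:
  assumes "qp_affine r \<alpha> \<beta> \<star>\<^bsub>q\<^esub> qp_affine s \<gamma> \<delta> = qp_form a b c"
  shows "a = \<alpha> * \<gamma>" "b = \<alpha> * \<delta> + \<beta> * \<gamma> * q" "c = \<beta> * \<delta>"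
  using arg_cong[OF assms, of "\<lambda>p. Poly_Mapping.lookup p (2, 0)"]
    arg_cong[OF assms, of "\<lambda>p. Poly_Mapping.lookup p (1, 1)"]
    arg_cong[OF assms, of "\<lambda>p. Poly_Mapping.lookup p (0, 2)"]
  by (simp_all add: qp_affine_def qp_form_def qp_mult_add_left qp_mult_add_right
      qp_mult_single lookup_add lookup_single when_def add.commute)

lemma qp_linear_mult:
  "qp_affine 0 \<alpha> \<beta> \<star>\<^bsub>q\<^esub> qp_affine 0 \<gamma> \<delta> =
    qp_form (\<alpha> * \<gamma>) (\<alpha> * \<delta> + \<beta> * \<gamma> * q) (\<beta> * \<delta>)"
  by (simp add: qp_affine_def qp_form_def qp_mult_add_left qp_mult_add_right
      qp_mult_single single_add numeral_2_eq_2 add_ac)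

theorem theorem6:
  fixes q a b c :: "'a::field_char_0" and f :: "'a qplane"
  assumes "q \<noteq> 0"
    and "f = qp_const a \<star>\<^bsub>q\<^esub> (qp_x \<star>\<^bsub>q\<^esub> qp_x)
           + qp_const b \<star>\<^bsub>q\<^esub> (qp_x \<star>\<^bsub>q\<^esub> qp_y)
           + qp_const c \<star>\<^bsub>q\<^esub> (qp_y \<star>\<^bsub>q\<^esub> qp_y)"
    and "f \<noteq> 0"
  shows "qp_reducible q f \<longleftrightarrow> (\<exists>d. b^2 - 4 * a * c * q = d^2)"
proof -
  have f: "f = qp_form a b c"
    unfolding assms(2)
    by (simp add: qp_form_def qp_const_def qp_x_def qp_y_def qp_mult_single numeral_2_eq_2)
  show ?thesis
  proof
    assume "qp_reducible q f"
    then obtain g h where gh: "g \<notin> range qp_const" "h \<notin> range qp_const" "f = g \<star>\<^bsub>q\<^esub> h"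
      by (auto simp: qp_reducible_def)
    have deg: "i + j \<le> 2" if "(i, j) \<in> Poly_Mapping.keys (g \<star>\<^bsub>q\<^esub> h)" for i j
      using that unfolding gh(3)[symmetric] f
      by (auto simp: qp_form_def in_keys_iff lookup_add lookup_single when_def split: if_splits)
    obtain r \<alpha> \<beta> where g: "g = qp_affine r \<alpha> \<beta>"
      using qp_affine_if_degree_le_1[OF qp_factors_linear(1)[OF \<open>q \<noteq> 0\<close> gh(1,2) deg]] by blast
    obtain s \<gamma> \<delta> where h: "h = qp_affine s \<gamma> \<delta>"
      using qp_affine_if_degree_le_1[OF qp_factors_linear(2)[OF \<open>q \<noteq> 0\<close> gh(1,2) deg]] by blast
    have "qp_affine r \<alpha> \<beta> \<star>\<^bsub>q\<^esub> qp_affine s \<gamma> \<delta> = qp_form a b c"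
      using gh(3) f g h by simp
    note coeffs = qp_affine_mult_top_coeffs[OF this]
    have "b^2 - 4 * a * c * q = (\<alpha> * \<delta> - \<beta> * \<gamma> * q)^2"
      unfolding coeffs by (simp add: power2_eq_square algebra_simps)
    then show "\<exists>d. b^2 - 4 * a * c * q = d^2" ..
  next
    assume "\<exists>d. b^2 - 4 * a * c * q = d^2"
    then obtain d where d: "b^2 - 4 * a * c * q = d^2" ..
    have reducible: "qp_reducible q f"
      if "\<alpha> \<noteq> 0 \<or> \<beta> \<noteq> 0" "\<gamma> \<noteq> 0 \<or> \<delta> \<noteq> 0"
        "a = \<alpha> * \<gamma>" "b = \<alpha> * \<delta> + \<beta> * \<gamma> * q" "c = \<beta> * \<delta>" for \<alpha> \<beta> \<gamma> \<delta>
      unfolding qp_reducible_def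
      using that \<open>f \<noteq> 0\<close> f qp_linear_mult[of q \<alpha> \<beta> \<gamma> \<delta>] qp_affine_nonconst by metis
    show "qp_reducible q f"
    proof (cases "a = 0")
      case True
      moreover from this have "b \<noteq> 0 \<or> c \<noteq> 0"
        using \<open>f \<noteq> 0\<close> f by (auto simp: qp_form_def)
      \<comment> \<open>Here \<open>f = (b x + c y) y\<close>.\<close>
      ultimately show ?thesis
        by (intro reducible[of b c 0 1]) auto
    next
      case False
      \<comment> \<open>With \<open>\<alpha> = a\<close> and \<open>\<gamma> = 1\<close>, the numbers \<open>\<alpha>\<delta>\<close> and \<open>q\<beta>\<close> have sum \<open>b\<close> and product \<open>acq\<close>,
        so they are the roots of a quadratic polynomial with discriminant \<open>d\<^sup>2\<close>.\<close>
      define \<beta> \<delta> where "\<beta> = (b - d) / (2 * q)" and "\<delta> = (b + d) / (2 * a)"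
      have "a * \<delta> + \<beta> * 1 * q = b"
        using False \<open>q \<noteq> 0\<close> by (simp add: \<beta>_def \<delta>_def field_simps)
      moreover have "\<beta> * \<delta> = (b^2 - d^2) / (4 * a * q)"
        by (simp add: \<beta>_def \<delta>_def power2_eq_square algebra_simps)
      then have "\<beta> * \<delta> = c"
        using False \<open>q \<noteq> 0\<close> by (simp flip: d)
      ultimately show ?thesis
        using False by (intro reducible[of a \<beta> 1 \<delta>]) auto
    qed
  qed
qed

end
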